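(* Let $d>0$ be a number and let $\alpha=\frac{n_1}{n_2}\in\left(0,\frac13\right)$, where $n_1,n_2>0$ are two odd integers. Then for all functions $f\in L_2(-d,d)$ and for all $\lambda>0$ $$\int_{-d}^{d}e^{-2\lambda t^{1+\alpha}}\left(\int_0^t f(\tau)\,d\tau\right)^2dt\;\le\;\frac{1}{\lambda^{3/2}}\cdot\frac{d^{(1-3\alpha)/2}}{\sqrt2\,(1+\alpha)^{3/2}}\int_{-d}^{d}f^2(t)\,e^{-2\lambda t^{1+\alpha}}dt .$$
   Context: All functions are real valued. Since $1+\alpha=(n_1+n_2)/n_2$ with $n_1+n_2$ even and $n_2$ odd, $t^{1+\alpha}$ is defined for all real $t$, including $t<0$, and $t^{1+\alpha}=(-t)^{1+\alpha}=|t|^{1+\alpha}$. *)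

theory Defs
  imports "HOL-Analysis.Analysis"
begin

text \<open>Representatives of the elements of \<open>L\<^sub>2(S)\<close>; values outside \<open>S\<close> are unconstrained.\<close>

definition L2_on :: "real set \<Rightarrow> (real \<Rightarrow> real) set" where
  "L2_on S = {f. f \<in> borel_measurable (lebesgue_on S) \<and> integrable (lebesgue_on S) (\<lambda>x. (f x)\<^sup>2)}"

text \<open>The real power \<open>t\<^bsup>m/n\<^esup>\<close>. For odd \<open>n\<close> the function \<open>root n\<close> is the real root, defined for
  negative arguments as well.\<close>

definition frac_power :: "real \<Rightarrow> nat \<Rightarrow> nat \<Rightarrow> real" where
  "frac_power t m n = root n (t ^ m)"

lemma frac_power_eq_abs_powr:
  assumes "n1 > 0" "n2 > 0" "odd n1" "odd n2"
  shows "frac_power t (n1 + n2) n2 = \<bar>t\<bar> powr (1 + real n1 / real n2)"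
proof -
  have "even (n1 + n2)" using assms by simp
  then have "t ^ (n1 + n2) = \<bar>t\<bar> ^ (n1 + n2)" by (simp add: power_even_abs)
  moreover have "1 + real n1 / real n2 = real (n1 + n2) / real n2"
    using assms by (simp add: field_simps)
  ultimately show ?thesis
    using assms
    by (cases "t = 0")
      (simp_all add: frac_power_def root_powr_inverse powr_realpow[symmetric] powr_powr)
qed

end

theory Submission
  imports Defs
begin

text \<open>
  Put \<open>w t = exp (- 2 * l * \<bar>t\<bar> powr (1 + \<alpha>))\<close> and let \<open>F\<close> be the primitive of \<open>\<bar>f\<bar>\<close>; by reflection it
  suffices to work on \<open>(0, d)\<close>. Tonelli gives \<open>(F t)\<^sup>2 \<le> 2 \<integral>\<^sub>0\<^sup>t \<bar>f\<bar> F\<close>. Since \<open>t powr \<alpha> * w t\<close> has the explicit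
  primitive \<open>- w t / (2 * l * (1 + \<alpha>))\<close>, the tail of \<open>w\<close> beyond \<open>s\<close> is at most
  \<open>s powr (- \<alpha>) * w s / (2 * l * (1 + \<alpha>))\<close>, so exchanging the integrals bounds \<open>\<integral> w F\<^sup>2\<close> by
  \<open>\<integral> \<bar>f\<bar> F s powr (- \<alpha>) w / (l * (1 + \<alpha>))\<close>. By Cauchy-Schwarz it remains to bound
  \<open>\<integral> F\<^sup>2 s powr (- 2 * \<alpha>) w\<close>; here \<open>(F s)\<^sup>2 \<le> s \<integral>\<^sub>0\<^sup>s f\<^sup>2\<close>, and the same tail estimate together with
  \<open>s powr (1 - 2 * \<alpha>) \<le> d powr (1 - 3 * \<alpha>) * s powr \<alpha>\<close> (the place where \<open>\<alpha> < 1 / 3\<close> enters) yields the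
  constant.
\<close>

section \<open>Squares and primitives of extended nonnegative functions\<close>

text \<open>Cauchy-Schwarz is available in squared form, so the half-line estimate is first proved
  between squares. If \<open>y\<close> is finite then so is \<open>x\<close>, and the real case
  applies.\<close>

lemma ennreal_le_of_power2_le:
  fixes x y :: ennreal
  assumes "x\<^sup>2 \<le> y\<^sup>2"
  shows "x \<le> y"
proof (cases y)
  case (real r)
  then have "x \<noteq> top"
    using assms by (auto simp: ennreal_power top_unique)
  then obtain q where "x = ennreal q" "0 \<le> q"
    by (cases x) auto
  with assms real show ?thesis
    by (auto simp: ennreal_power intro: power2_le_imp_le)
qed simp

text \<open>The lower limit is minus infinity; \<open>prim\<close> is only applied to functions vanishing on the negative half-line
  when the starting point matters.\<close>

definition prim :: "(real \<Rightarrow> ennreal) \<Rightarrow> real \<Rightarrow> ennreal" where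
  "prim h t = (\<integral>\<^sup>+x. h x * (if x \<le> t then 1 else 0) \<partial>lborel)"

lemma measurable_prim [measurable]:
  assumes [measurable]: "h \<in> borel_measurable borel"
  shows "prim h \<in> borel_measurable borel"
  unfolding prim_def by measurable

text \<open>Tonelli on the region \<open>x \<le> t\<close>. It turns a weighted integral of a
  primitive into one over tails of the weight, to which the tail estimates apply.\<close>

lemma nn_integral_mult_prim:
  assumes [measurable]: "u \<in> borel_measurable borel" "h \<in> borel_measurable borel"
  shows "(\<integral>\<^sup>+t. u t * prim h t \<partial>lborel)
    = (\<integral>\<^sup>+x. h x * (\<integral>\<^sup>+t. u t * (if x \<le> t then 1 else 0) \<partial>lborel) \<partial>lborel)"
proof -
  have "(\<integral>\<^sup>+t. u t * prim h t \<partial>lborel)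
      = (\<integral>\<^sup>+t. (\<integral>\<^sup>+x. h x * (u t * (if x \<le> t then 1 else 0)) \<partial>lborel) \<partial>lborel)"
    unfolding prim_def by (subst nn_integral_cmult[symmetric]) (auto simp: ac_simps)
  also have "\<dots> = (\<integral>\<^sup>+x. (\<integral>\<^sup>+t. h x * (u t * (if x \<le> t then 1 else 0)) \<partial>lborel) \<partial>lborel)"
    by (rule lborel_pair.Fubini') measurable
  also have "\<dots> = (\<integral>\<^sup>+x. h x * (\<integral>\<^sup>+t. u t * (if x \<le> t then 1 else 0) \<partial>lborel) \<partial>lborel)"
    by (subst nn_integral_cmult[symmetric]) auto
  finally show ?thesis .
qed

text \<open>The square is a double integral of \<open>h x * h y\<close> over
  \<open>x, y \<le> t\<close>; the halves \<open>x \<le> y\<close> and \<open>y \<le> x\<close>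
  contribute equally. This replaces integrating the derivative of the squared primitive, so infinite
  values are allowed.\<close>

lemma prim_power2_le:
  assumes [measurable]: "h \<in> borel_measurable borel"
  shows "(prim h t)\<^sup>2 \<le> 2 * prim (\<lambda>y. h y * prim h y) t"
proof -
  define g where "g x = h x * (if x \<le> t then 1 else 0)" for x
  have [measurable]: "g \<in> borel_measurable borel"
    unfolding g_def by measurable
  define T where "T = (\<integral>\<^sup>+y. g y * prim g y \<partial>lborel)"
  have "(prim h t)\<^sup>2 = (\<integral>\<^sup>+y. g y * (\<integral>\<^sup>+x. g x \<partial>lborel) \<partial>lborel)"
    by (subst nn_integral_multc) (auto simp: prim_def g_def[abs_def] power2_eq_square)
  \<comment> \<open>The two regions overlap on the diagonal, hence an inequality.\<close>
  also have "\<dots> \<le> (\<integral>\<^sup>+y. g y * (prim g y + (\<integral>\<^sup>+x. g x * (if y \<le> x then 1 else 0) \<partial>lborel)) \<partial>lborel)"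
    unfolding prim_def
    by (intro nn_integral_mono mult_left_mono, subst nn_integral_add[symmetric])
       (auto intro!: nn_integral_mono)
  also have "\<dots> = T + (\<integral>\<^sup>+y. g y * (\<integral>\<^sup>+x. g x * (if y \<le> x then 1 else 0) \<partial>lborel) \<partial>lborel)"
    unfolding distrib_left T_def by (subst nn_integral_add) auto
  \<comment> \<open>Exchanging the order of integration turns the second summand into
    \<open>T\<close>.\<close>
  also have "\<dots> = 2 * T"
    by (subst nn_integral_mult_prim[symmetric]) (auto simp: T_def mult_2)
  also have "T \<le> prim (\<lambda>y. h y * prim h y) t"
    unfolding T_def prim_def[of _ t]
    by (intro nn_integral_mono) (auto simp: g_def prim_def intro!: mult_left_mono nn_integral_mono)
  finally show ?thesis by (simp add: mult_left_mono)
qed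

text \<open>Cauchy-Schwarz with the indicator of \<open>{0..t}\<close> as second factor, which may
  be inserted because \<open>h\<close> vanishes on the negative half-line.\<close>

lemma prim_power2_le_mult_prim_power2:
  assumes [measurable]: "h \<in> borel_measurable borel"
    and "\<And>x. x \<le> 0 \<Longrightarrow> h x = 0" "t \<ge> 0"
  shows "(prim h t)\<^sup>2 \<le> ennreal t * prim (\<lambda>x. (h x)\<^sup>2) t"
proof -
  have "(prim h t)\<^sup>2 = (\<integral>\<^sup>+x. (h x * (if x \<le> t then 1 else 0)) * indicator {0..t} x \<partial>lborel)\<^sup>2"
    unfolding prim_def
    by (intro arg_cong[where f = "\<lambda>x. x\<^sup>2"] nn_integral_cong)
       (use assms(2) in \<open>force split: split_indicator\<close>)
  also have "\<dots> \<le> (\<integral>\<^sup>+x. (h x * (if x \<le> t then 1 else 0))\<^sup>2 \<partial>lborel) * (\<integral>\<^sup>+x. (indicator {0..t} x)\<^sup>2 \<partial>lborel)"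
    by (rule Cauchy_Schwarz_nn_integral) measurable
  also have "(\<integral>\<^sup>+x. (indicator {0..t} x :: ennreal)\<^sup>2 \<partial>lborel) = ennreal t"
    using assms(3) by (simp add: power2_eq_square flip: indicator_inter_arith)
  also have "(\<integral>\<^sup>+x. (h x * (if x \<le> t then 1 else 0))\<^sup>2 \<partial>lborel) = prim (\<lambda>x. (h x)\<^sup>2) t"
    unfolding prim_def by (intro nn_integral_cong) auto
  finally show ?thesis by (simp add: mult.commute)
qed

section \<open>Tail estimates for the weight\<close>

lemma nn_integral_powr_exp_le:
  fixes a c y d :: real
  assumes "a > 0" "c > 0" "y > 0"
  shows "(\<integral>\<^sup>+t. ennreal (t powr a * exp (- c * t powr (1 + a))) * indicator {y..d} t \<partial>lborel)
    \<le> ennreal (exp (- c * y powr (1 + a)) / (c * (1 + a)))"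
proof (cases "y \<le> d")
  case True
  \<comment> \<open>This factor normalizes the derivative of \<open>E\<close> to the integrand;
    being negative, it also lets the boundary term \<open>E d\<close> be dropped at the end.\<close>
  define k where "k = - 1 / (c * (1 + a))"
  define E where "E t = k * exp (- c * t powr (1 + a))" for t
  have k: "k * (c * (1 + a)) = - 1" and "k < 0"
    using assms by (simp_all add: k_def divide_neg_pos)
  have "(\<integral>\<^sup>+t. ennreal (t powr a * exp (- c * t powr (1 + a))) * indicator {y..d} t \<partial>lborel)
      = ennreal (E d - E y)"
  proof (rule nn_integral_FTC_Icc)
    fix t assume "t \<in> {y..d}"
    then have "t > 0" using assms by simp
    then have "(E has_real_derivative - (k * (c * (1 + a))) * (t powr a * exp (- c * t powr (1 + a))))
        (at t)"
      unfolding E_def by (auto intro!: derivative_eq_intros simp: algebra_simps)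
    then show "(E has_real_derivative t powr a * exp (- c * t powr (1 + a))) (at t)"
      unfolding k by simp
  qed (use True in auto)
  also have "\<dots> \<le> ennreal (exp (- c * y powr (1 + a)) / (c * (1 + a)))"
    using assms \<open>k < 0\<close> by (intro ennreal_leI) (auto simp: E_def k_def)
  finally show ?thesis .
qed auto

text \<open>The cut-off confines integrals over the whole line to \<open>(0, d)\<close>, where
  \<open>t\<close> and \<open>\<bar>t\<bar>\<close> agree.\<close>

definition wt :: "real \<Rightarrow> real \<Rightarrow> real \<Rightarrow> real \<Rightarrow> ennreal" where
  "wt l a d t = ennreal (exp (- 2 * l * t powr (1 + a))) * indicator {0<..<d} t"

lemma measurable_wt [measurable]: "wt l a d \<in> borel_measurable borel"
  unfolding wt_def by measurable

text \<open>Beyond \<open>y\<close> the integrand is at most \<open>M\<close> times one with an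
  explicit primitive. \<open>M\<close> may depend on \<open>y\<close>: the two uses take
  \<open>u = 1\<close> with \<open>M = y powr - a\<close>, and
  \<open>u t = t powr (1 - 2 * a)\<close> with \<open>M = d powr (1 - 3 * a)\<close>.\<close>

lemma nn_integral_wt_tail_le:
  fixes a l d y M :: real and u :: "real \<Rightarrow> real"
  assumes "a > 0" "l > 0" "y > 0" "y < d" "M \<ge> 0"
    and u: "\<And>t. y \<le> t \<Longrightarrow> t < d \<Longrightarrow> u t \<le> M * t powr a"
  shows "(\<integral>\<^sup>+t. wt l a d t * ennreal (u t) * (if y \<le> t then 1 else 0) \<partial>lborel)
    \<le> ennreal (M / (2 * l * (1 + a))) * wt l a d y"
proof -
  have "(\<integral>\<^sup>+t. wt l a d t * ennreal (u t) * (if y \<le> t then 1 else 0) \<partial>lborel)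
      \<le> (\<integral>\<^sup>+t. ennreal M * (ennreal (t powr a * exp (- (2 * l) * t powr (1 + a))) * indicator {y..d} t) \<partial>lborel)"
  proof (intro nn_integral_mono)
    fix t :: real
    have "wt l a d t * ennreal (u t) \<le> ennreal M * ennreal (t powr a * exp (- (2 * l) * t powr (1 + a)))"
      if "y \<le> t" "t < d"
    proof -
      have "wt l a d t * ennreal (u t) \<le> ennreal (exp (- 2 * l * t powr (1 + a))) * ennreal (M * t powr a)"
        using that assms(3) u[OF that]
        by (auto simp: wt_def intro!: mult_left_mono ennreal_leI)
      also have "\<dots> = ennreal M * ennreal (t powr a * exp (- (2 * l) * t powr (1 + a)))"
        using \<open>M \<ge> 0\<close> by (simp add: ac_simps flip: ennreal_mult)
      finally show ?thesis .
    qed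
    then show "wt l a d t * ennreal (u t) * (if y \<le> t then 1 else 0)
      \<le> ennreal M * (ennreal (t powr a * exp (- (2 * l) * t powr (1 + a))) * indicator {y..d} t)"
      by (cases "t < d") (auto simp: wt_def split: split_indicator)
  qed
  also have "\<dots> = ennreal M *
      (\<integral>\<^sup>+t. ennreal (t powr a * exp (- (2 * l) * t powr (1 + a))) * indicator {y..d} t \<partial>lborel)"
    by (rule nn_integral_cmult) measurable
  also have "\<dots> \<le> ennreal M * ennreal (exp (- (2 * l) * y powr (1 + a)) / (2 * l * (1 + a)))"
    using assms by (intro mult_left_mono nn_integral_powr_exp_le) auto
  also have "\<dots> = ennreal (M / (2 * l * (1 + a))) * wt l a d y"
    using assms by (simp add: wt_def flip: ennreal_mult)
  finally show ?thesis .
qed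

section \<open>The inequality on the half-interval\<close>

lemma weighted_hardy_half_line:
  fixes a l d :: real and h :: "real \<Rightarrow> ennreal"
  assumes "0 < a" "a < 1 / 3" "l > 0" "d > 0"
    and [measurable]: "h \<in> borel_measurable borel"
    and h0: "\<And>x. x \<notin> {0<..<d} \<Longrightarrow> h x = 0"
  shows "(\<integral>\<^sup>+t. wt l a d t * (prim h t)\<^sup>2 \<partial>lborel)
    \<le> ennreal (1 / l powr (3/2) * (d powr ((1 - 3 * a) / 2) / (sqrt 2 * (1 + a) powr (3/2))))
      * (\<integral>\<^sup>+t. (h t)\<^sup>2 * wt l a d t \<partial>lborel)"
proof -
  define v where "v = wt l a d"
  have [measurable]: "v \<in> borel_measurable borel"
    unfolding v_def by measurable
  \<comment> \<open>The square root of the weight, so that each Cauchy-Schwarz factor of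
    \<open>X\<close> receives one copy.\<close>
  define s where "s t = ennreal (exp (- l * t powr (1 + a))) * indicator {0<..<d} t" for t
  have [measurable]: "s \<in> borel_measurable borel"
    unfolding s_def by measurable
  have s2: "(s t)\<^sup>2 = v t" for t
    by (auto simp: s_def v_def wt_def ennreal_power simp flip: exp_of_nat_mult split: split_indicator)
  define q where "q y = h y * prim h y" for y
  have [measurable]: "q \<in> borel_measurable borel"
    unfolding q_def by measurable
  define I where "I = (\<integral>\<^sup>+t. v t * (prim h t)\<^sup>2 \<partial>lborel)"
  define K where "K = (\<integral>\<^sup>+t. (h t)\<^sup>2 * v t \<partial>lborel)"
  define J where "J = (\<integral>\<^sup>+t. (prim h t * ennreal (t powr - a) * s t)\<^sup>2 \<partial>lborel)"
  define X where "X = (\<integral>\<^sup>+t. (h t * s t) * (prim h t * ennreal (t powr - a) * s t) \<partial>lborel)"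
  define A where "A = d powr (1 - 3 * a) / (2 * l * (1 + a))"
  define C where "C = 1 / l powr (3/2) * (d powr ((1 - 3 * a) / 2) / (sqrt 2 * (1 + a) powr (3/2)))"

  have "I \<le> (\<integral>\<^sup>+t. v t * (2 * prim q t) \<partial>lborel)"
    unfolding I_def q_def by (intro nn_integral_mono mult_left_mono prim_power2_le) auto
  also have "\<dots> = 2 * (\<integral>\<^sup>+t. v t * prim q t \<partial>lborel)"
    by (subst nn_integral_cmult[symmetric]) (auto simp: ac_simps)
  also have "(\<integral>\<^sup>+t. v t * prim q t \<partial>lborel)
      = (\<integral>\<^sup>+y. q y * (\<integral>\<^sup>+t. v t * (if y \<le> t then 1 else 0) \<partial>lborel) \<partial>lborel)"
    by (rule nn_integral_mult_prim) measurable
  also have "\<dots> \<le> (\<integral>\<^sup>+y. ennreal (1 / (2 * l * (1 + a))) *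
      ((h y * s y) * (prim h y * ennreal (y powr - a) * s y)) \<partial>lborel)"
  proof (intro nn_integral_mono)
    fix y :: real
    show "q y * (\<integral>\<^sup>+t. v t * (if y \<le> t then 1 else 0) \<partial>lborel)
      \<le> ennreal (1 / (2 * l * (1 + a))) * ((h y * s y) * (prim h y * ennreal (y powr - a) * s y))"
    proof (cases "y \<in> {0<..<d}")
      case True
      have "(\<integral>\<^sup>+t. v t * ennreal 1 * (if y \<le> t then 1 else 0) \<partial>lborel)
          \<le> ennreal (y powr - a / (2 * l * (1 + a))) * v y"
        unfolding v_def
      proof (rule nn_integral_wt_tail_le)
        \<comment> \<open>As \<open>a > 0\<close>, \<open>t powr a\<close> is at least
          \<open>y powr a\<close> on the tail, which justifies
          \<open>M = y powr - a\<close>.\<close>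
        fix t assume "y \<le> t"
        then have "y powr - a * y powr a \<le> y powr - a * t powr a"
          using True assms by (intro mult_left_mono powr_mono2) auto
        then show "1 \<le> y powr - a * t powr a"
          using True by (simp flip: powr_add)
      qed (use True assms in auto)
      also have "\<dots> = ennreal (1 / (2 * l * (1 + a))) * ennreal (y powr - a) * (s y)\<^sup>2"
        using assms by (simp add: s2 flip: ennreal_mult)
      finally have "q y * (\<integral>\<^sup>+t. v t * (if y \<le> t then 1 else 0) \<partial>lborel)
          \<le> q y * (ennreal (1 / (2 * l * (1 + a))) * ennreal (y powr - a) * (s y)\<^sup>2)"
        by (intro mult_left_mono) auto
      then show ?thesis by (simp add: q_def power2_eq_square ac_simps)
    qed (simp add: q_def h0)
  qed
  also have "\<dots> = ennreal (1 / (2 * l * (1 + a))) * X"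
    unfolding X_def by (rule nn_integral_cmult) measurable
  also have "2 * (ennreal (1 / (2 * l * (1 + a))) * X) = ennreal (1 / (l * (1 + a))) * X"
  proof -
    have "2 * ennreal (1 / (2 * l * (1 + a))) = ennreal (2 * (1 / (2 * l * (1 + a))))"
      using assms by (subst ennreal_mult) auto
    also have "2 * (1 / (2 * l * (1 + a))) = 1 / (l * (1 + a))" by simp
    finally show ?thesis by (simp only: mult.assoc[symmetric])
  qed
  finally have IX: "I \<le> ennreal (1 / (l * (1 + a))) * X" by (simp add: mult_left_mono)

  have "J \<le> (\<integral>\<^sup>+t. (v t * ennreal (t powr (1 - 2 * a))) * prim (\<lambda>x. (h x)\<^sup>2) t \<partial>lborel)"
    unfolding J_def
  proof (intro nn_integral_mono)
    fix t :: real
    show "(prim h t * ennreal (t powr - a) * s t)\<^sup>2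
      \<le> (v t * ennreal (t powr (1 - 2 * a))) * prim (\<lambda>x. (h x)\<^sup>2) t"
    proof (cases "t \<in> {0<..<d}")
      case True
      \<comment> \<open>The factor \<open>t\<close> comes from bounding the squared primitive, the
        other from the square in \<open>J\<close>.\<close>
      have e: "(ennreal (t powr - a))\<^sup>2 * ennreal t = ennreal (t powr (1 - 2 * a))"
      proof -
        have "(t powr - a)\<^sup>2 * t = t powr - a * t powr - a * t powr 1"
          using True by (simp add: power2_eq_square)
        also have "\<dots> = t powr (1 - 2 * a)"
          unfolding powr_add[symmetric] by (simp add: algebra_simps)
        finally show ?thesis using True by (simp add: ennreal_power flip: ennreal_mult)
      qed
      have "(prim h t * ennreal (t powr - a) * s t)\<^sup>2 = (prim h t)\<^sup>2 * ((ennreal (t powr - a))\<^sup>2 * v t)"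
        by (simp add: power_mult_distrib s2 ac_simps)
      also have "\<dots> \<le> (ennreal t * prim (\<lambda>x. (h x)\<^sup>2) t) * ((ennreal (t powr - a))\<^sup>2 * v t)"
        using True h0 by (intro mult_right_mono prim_power2_le_mult_prim_power2) auto
      also have "\<dots> = (v t * ((ennreal (t powr - a))\<^sup>2 * ennreal t)) * prim (\<lambda>x. (h x)\<^sup>2) t"
        by (simp add: ac_simps)
      finally show ?thesis unfolding e .
    qed (auto simp: s_def)
  qed
  also have "\<dots> = (\<integral>\<^sup>+x. (h x)\<^sup>2 *
      (\<integral>\<^sup>+t. v t * ennreal (t powr (1 - 2 * a)) * (if x \<le> t then 1 else 0) \<partial>lborel) \<partial>lborel)"
    by (rule nn_integral_mult_prim) measurable
  also have "\<dots> \<le> (\<integral>\<^sup>+x. ennreal A * ((h x)\<^sup>2 * v x) \<partial>lborel)"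
  proof (intro nn_integral_mono)
    fix x :: real
    show "(h x)\<^sup>2 * (\<integral>\<^sup>+t. v t * ennreal (t powr (1 - 2 * a)) * (if x \<le> t then 1 else 0) \<partial>lborel)
      \<le> ennreal A * ((h x)\<^sup>2 * v x)"
    proof (cases "x \<in> {0<..<d}")
      case True
      have "(\<integral>\<^sup>+t. v t * ennreal (t powr (1 - 2 * a)) * (if x \<le> t then 1 else 0) \<partial>lborel)
          \<le> ennreal A * v x"
        unfolding v_def A_def
      proof (rule nn_integral_wt_tail_le)
        fix t assume "x \<le> t" "t < d"
        have "t powr (1 - 2 * a) = t powr (1 - 3 * a) * t powr a"
          unfolding powr_add[symmetric] by simp
        also have "\<dots> \<le> d powr (1 - 3 * a) * t powr a"
          using True \<open>x \<le> t\<close> \<open>t < d\<close> assms by (intro mult_right_mono powr_mono2) auto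
        finally show "t powr (1 - 2 * a) \<le> d powr (1 - 3 * a) * t powr a" .
      qed (use True assms in auto)
      from mult_left_mono[OF this, of "(h x)\<^sup>2"] show ?thesis by (simp add: ac_simps)
    qed (simp add: h0)
  qed
  also have "\<dots> = ennreal A * K"
    unfolding K_def by (rule nn_integral_cmult) measurable
  finally have JK: "J \<le> ennreal A * K" .

  have "X\<^sup>2 \<le> (\<integral>\<^sup>+t. (h t * s t)\<^sup>2 \<partial>lborel) * J"
    unfolding X_def J_def by (rule Cauchy_Schwarz_nn_integral) measurable
  also have "(\<integral>\<^sup>+t. (h t * s t)\<^sup>2 \<partial>lborel) = K"
    by (simp add: K_def power_mult_distrib s2)
  finally have XK: "X\<^sup>2 \<le> K * (ennreal A * K)"
    using JK by (meson mult_left_mono order_trans zero_le)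

  \<comment> \<open>\<open>IX\<close> and \<open>XK\<close> are combined between squares:
    \<open>K\<close> appears squared on the right, so nothing is divided by \<open>K\<close> and it
    may be infinite.\<close>
  have "I\<^sup>2 \<le> (ennreal (1 / (l * (1 + a))) * X)\<^sup>2"
    using IX by (intro power_mono) auto
  also have "\<dots> \<le> (ennreal (1 / (l * (1 + a))))\<^sup>2 * (K * (ennreal A * K))"
    unfolding power_mult_distrib using XK by (intro mult_left_mono) auto
  also have "\<dots> = ((ennreal (1 / (l * (1 + a))))\<^sup>2 * ennreal A) * K\<^sup>2"
    by (simp add: power2_eq_square ac_simps)
  also have "(ennreal (1 / (l * (1 + a))))\<^sup>2 * ennreal A = (ennreal C)\<^sup>2"
  proof -
    have cube: "(z powr (3/2))\<^sup>2 = z ^ 3" if "z > 0" for z :: real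
      using that by (simp add: power2_eq_square flip: powr_add)
    have dd: "(d powr ((1 - 3 * a) / 2))\<^sup>2 = d powr (1 - 3 * a)"
      by (simp add: power2_eq_square flip: powr_add)
    \<comment> \<open>The factor \<open>1 / (2 * l * (1 + a))\<close> in \<open>A\<close> joins the
      square of \<open>1 / (l * (1 + a))\<close>; the root of the resulting cubes gives the
      exponents \<open>3/2\<close> and the \<open>sqrt 2\<close>.\<close>
    have "C\<^sup>2 = d powr (1 - 3 * a) / (l ^ 3 * (2 * (1 + a) ^ 3))"
      using assms by (simp add: C_def power_mult_distrib power_divide cube dd)
    also have "\<dots> = (1 / (l * (1 + a)))\<^sup>2 * A"
      by (simp add: A_def power2_eq_square power3_eq_cube ac_simps)
    finally have CA: "C\<^sup>2 = (1 / (l * (1 + a)))\<^sup>2 * A" .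
    have "C \<ge> 0" "A \<ge> 0" using assms by (simp_all add: C_def A_def)
    then have "(ennreal (1 / (l * (1 + a))))\<^sup>2 * ennreal A = ennreal ((1 / (l * (1 + a)))\<^sup>2 * A)"
      using assms by (simp add: ennreal_power ennreal_mult)
    also have "\<dots> = (ennreal C)\<^sup>2"
      using \<open>C \<ge> 0\<close> by (simp add: CA ennreal_power)
    finally show ?thesis .
  qed
  finally have "I\<^sup>2 \<le> (ennreal C * K)\<^sup>2"
    by (simp add: power_mult_distrib)
  then show ?thesis
    unfolding I_def K_def C_def v_def by (rule ennreal_le_of_power2_le)
qed

section \<open>The symmetric interval by reflection\<close>

text \<open>Reflection turns the part with \<open>t < 0\<close> into a second half-line problem, for
  \<open>k\<close>. Both halves have the same constant, so their bounds add.\<close>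

lemma weighted_hardy:
  fixes a l d :: real and g :: "real \<Rightarrow> ennreal"
  assumes "0 < a" "a < 1 / 3" "l > 0" "d > 0"
    and [measurable]: "g \<in> borel_measurable borel"
  shows "(\<integral>\<^sup>+t. ennreal (exp (- 2 * l * \<bar>t\<bar> powr (1 + a))) * indicator {-d<..<d} t
      * (\<integral>\<^sup>+x. g x * indicator {min 0 t<..<max 0 t} x \<partial>lborel)\<^sup>2 \<partial>lborel)
    \<le> ennreal (1 / l powr (3/2) * (d powr ((1 - 3 * a) / 2) / (sqrt 2 * (1 + a) powr (3/2))))
      * (\<integral>\<^sup>+t. (g t)\<^sup>2 * (ennreal (exp (- 2 * l * \<bar>t\<bar> powr (1 + a))) * indicator {-d<..<d} t) \<partial>lborel)"
    (is "?L \<le> ennreal ?C * ?R")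
proof -
  have reflect: "(\<integral>\<^sup>+t. u (- t) \<partial>lborel) = (\<integral>\<^sup>+t. u t \<partial>lborel)"
    if "u \<in> borel_measurable borel" for u :: "real \<Rightarrow> ennreal"
    using nn_integral_real_affine[OF that, of "- 1" 0] by simp
  define h k where "h x = g x * indicator {0<..<d} x" and "k x = g (- x) * indicator {0<..<d} x" for x
  have [measurable]: "h \<in> borel_measurable borel" "k \<in> borel_measurable borel"
    unfolding h_def k_def by measurable
  define I where "I u = (\<integral>\<^sup>+t. wt l a d t * (prim u t)\<^sup>2 \<partial>lborel)" for u
  define K where "K u = (\<integral>\<^sup>+t. (u t)\<^sup>2 * wt l a d t \<partial>lborel)" for u :: "real \<Rightarrow> ennreal"
  have "?L \<le> (\<integral>\<^sup>+t. wt l a d t * (prim h t)\<^sup>2 + wt l a d (- t) * (prim k (- t))\<^sup>2 \<partial>lborel)"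
  proof (intro nn_integral_mono)
    fix t :: real
    let ?P = "\<integral>\<^sup>+x. g x * indicator {min 0 t<..<max 0 t} x \<partial>lborel"
    let ?w = "ennreal (exp (- 2 * l * \<bar>t\<bar> powr (1 + a))) * indicator {-d<..<d} t"
    \<comment> \<open>In the first two cases the left side is 0: the inner interval is empty, or the
      weight is cut off.\<close>
    consider "t = 0" | "t \<notin> {-d<..<d}" | "0 < t" "t < d" | "- d < t" "t < 0"
      by fastforce
    then show "?w * ?P\<^sup>2 \<le> wt l a d t * (prim h t)\<^sup>2 + wt l a d (- t) * (prim k (- t))\<^sup>2"
    proof cases
      case 3
      then have "?P \<le> prim h t"
        unfolding prim_def by (intro nn_integral_mono) (auto simp: h_def split: split_indicator)
      moreover have "?w = wt l a d t" using 3 by (simp add: wt_def)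
      ultimately show ?thesis
        by (auto intro!: add_increasing2 mult_left_mono power_mono)
    next
      case 4
      have "?P = (\<integral>\<^sup>+x. g (- x) * indicator {min 0 t<..<max 0 t} (- x) \<partial>lborel)"
        by (rule reflect[symmetric]) measurable
      also have "\<dots> \<le> prim k (- t)"
        unfolding prim_def using 4 by (intro nn_integral_mono) (auto simp: k_def split: split_indicator)
      finally have "?P \<le> prim k (- t)" .
      moreover have "?w = wt l a d (- t)" using 4 by (simp add: wt_def)
      ultimately show ?thesis
        by (auto intro!: add_increasing mult_left_mono power_mono)
    qed auto
  qed
  also have "\<dots> = I h + (\<integral>\<^sup>+t. wt l a d (- t) * (prim k (- t))\<^sup>2 \<partial>lborel)"
    unfolding I_def by (rule nn_integral_add) measurable
  also have "(\<integral>\<^sup>+t. wt l a d (- t) * (prim k (- t))\<^sup>2 \<partial>lborel) = I k"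
    unfolding I_def by (rule reflect) measurable
  also have "I h + I k \<le> ennreal ?C * K h + ennreal ?C * K k"
    unfolding I_def K_def using assms
    by (intro add_mono weighted_hardy_half_line) (auto simp: h_def k_def)
  also have "\<dots> = ennreal ?C * (K h + K k)" by (simp add: distrib_left)
  also have "K k = (\<integral>\<^sup>+t. (k (- t))\<^sup>2 * wt l a d (- t) \<partial>lborel)"
    unfolding K_def by (rule reflect[symmetric]) measurable
  also have "K h + \<dots> = (\<integral>\<^sup>+t. (h t)\<^sup>2 * wt l a d t + (k (- t))\<^sup>2 * wt l a d (- t) \<partial>lborel)"
    unfolding K_def by (rule nn_integral_add[symmetric]) measurable
  \<comment> \<open>The two summands have disjoint supports, which miss only \<open>t = 0\<close> in
    the interval.\<close>
  also have "\<dots> \<le> ?R"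
    by (intro nn_integral_mono) (auto simp: h_def k_def wt_def split: split_indicator)
  finally show ?thesis by (simp add: mult_left_mono)
qed

section \<open>Transfer to Lebesgue integrals of real functions\<close>

text \<open>Orientation affects only the sign, and a non-integrable integrand has the default
  integral 0. Completing the measure leaves nonnegative integrals unchanged, so
  \<open>lborel\<close> may stand on the right.\<close>

lemma interval_lebesgue_integral_abs_le:
  fixes f :: "real \<Rightarrow> real"
  shows "ennreal \<bar>LINT x=ereal a..ereal b|lebesgue. f x\<bar>
    \<le> (\<integral>\<^sup>+x. ennreal \<bar>f x\<bar> * indicator {min a b<..<max a b} x \<partial>lborel)"
proof -
  have "ennreal \<bar>integral\<^sup>L lebesgue (\<lambda>x. indicator {min a b<..<max a b} x *\<^sub>R f x)\<bar>
      \<le> (\<integral>\<^sup>+x. norm (indicator {min a b<..<max a b} x *\<^sub>R f x) \<partial>lebesgue)"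
    using integral_norm_bound_ennreal[of lebesgue "\<lambda>x. indicator {min a b<..<max a b} x *\<^sub>R f x"]
    by (cases "integrable lebesgue (\<lambda>x. indicator {min a b<..<max a b} x *\<^sub>R f x)")
       (simp_all add: not_integrable_integral_eq)
  also have "\<dots> = (\<integral>\<^sup>+x. ennreal \<bar>f x\<bar> * indicator {min a b<..<max a b} x \<partial>lborel)"
    unfolding nn_integral_completion
    by (intro nn_integral_cong) (auto split: split_indicator)
  finally show ?thesis
    by (cases "a \<le> b")
       (auto simp: interval_lebesgue_integral_def set_lebesgue_integral_def min_def max_def)
qed

theorem theorem4p1:
  fixes d \<alpha> :: real and n1 n2 :: nat
  assumes "d > 0"
    and "n1 > 0" and "n2 > 0" and "odd n1" and "odd n2"
    and "\<alpha> = real n1 / real n2" and "0 < \<alpha>" and "\<alpha> < 1 / 3"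
  shows "\<forall>f \<in> L2_on {-d<..<d}. \<forall>l::real. l > 0 \<longrightarrow>
    (LINT t=ereal (-d)..ereal d|lebesgue.
        (exp (-2 * l * frac_power t (n1 + n2) n2) * (LINT \<tau>=ereal 0..ereal t|lebesgue. (f \<tau>))\<^sup>2))
    \<le> 1 / l powr (3/2) * (d powr ((1 - 3 * \<alpha>) / 2) / (sqrt 2 * (1 + \<alpha>) powr (3/2)))
       * (LINT t=ereal (-d)..ereal d|lebesgue.
            ((f t)\<^sup>2 * exp (-2 * l * frac_power t (n1 + n2) n2)))"
proof (intro ballI allI impI)
  fix f :: "real \<Rightarrow> real" and l :: real
  assume f: "f \<in> L2_on {-d<..<d}" and "l > 0"
  define S where "S = {-d<..<d}"
  define w where "w t = exp (- 2 * l * \<bar>t\<bar> powr (1 + \<alpha>))" for t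
  have w: "exp (-2 * l * frac_power t (n1 + n2) n2) = w t" for t
    using assms frac_power_eq_abs_powr[of n1 n2 t] by (simp add: w_def)
  have w_borel [measurable]: "w \<in> borel_measurable borel"
    unfolding w_def by measurable
  have w_le: "0 \<le> w t" "w t \<le> 1" for t
    using \<open>l > 0\<close> by (simp_all add: w_def)
  define C where "C = 1 / l powr (3/2) * (d powr ((1 - 3 * \<alpha>) / 2) / (sqrt 2 * (1 + \<alpha>) powr (3/2)))"
  have "C \<ge> 0" using assms by (simp add: C_def)
  define F where "F t = (LINT \<tau>=ereal 0..ereal t|lebesgue. f \<tau>)" for t
  define K where "K = (LINT t:S|lebesgue. (f t)\<^sup>2 * w t)"

  have "(\<lambda>x. indicator S x *\<^sub>R f x) \<in> borel_measurable lebesgue"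
    and f2: "integrable lebesgue (\<lambda>x. indicator S x *\<^sub>R (f x)\<^sup>2)"
    using f by (simp_all add: L2_on_def S_def borel_measurable_restrict_space_iff integrable_restrict_space)
  \<comment> \<open>The estimates above are for Borel functions, so \<open>f\<close>, cut off to
    \<open>S\<close>, is replaced by a Borel function equal to it almost everywhere.\<close>
  then obtain g where g [measurable]: "g \<in> borel_measurable lborel"
    and fg: "AE x in lborel. indicator S x *\<^sub>R f x = g x"
    using completion_ex_borel_measurable_real by blast
  \<comment> \<open>As \<open>w \<le> 1\<close>, the integrand is dominated by the square of
    \<open>f\<close>; thus \<open>K\<close> is a genuine integral and not a default value.\<close>
  have "integrable lebesgue (\<lambda>x. indicator S x *\<^sub>R ((f x)\<^sup>2 * w x))"
  proof (rule Bochner_Integration.integrable_bound[OF f2])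
    have "w \<in> borel_measurable lebesgue"
      using w_borel by (simp add: measurable_completion)
    from borel_measurable_times[OF borel_measurable_integrable[OF f2] this]
    show "(\<lambda>x. indicator S x *\<^sub>R ((f x)\<^sup>2 * w x)) \<in> borel_measurable lebesgue"
      by (simp add: ac_simps)
  qed (use w_le in \<open>auto simp: abs_mult mult_left_le split: split_indicator\<close>)
  then have "ennreal K = (\<integral>\<^sup>+x. ennreal (indicator S x *\<^sub>R ((f x)\<^sup>2 * w x)) \<partial>lebesgue)"
    unfolding K_def set_lebesgue_integral_def
    using w_le by (intro nn_integral_eq_integral[symmetric]) auto
  also have "\<dots> = (\<integral>\<^sup>+x. (ennreal \<bar>g x\<bar>)\<^sup>2 * (ennreal (w x) * indicator S x) \<partial>lborel)"
    unfolding nn_integral_completion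
    by (intro nn_integral_cong_AE, use fg in eventually_elim)
       (use w_le in \<open>auto simp: ennreal_power ennreal_mult split: split_indicator\<close>)
  finally have K: "(\<integral>\<^sup>+x. (ennreal \<bar>g x\<bar>)\<^sup>2 * (ennreal (w x) * indicator S x) \<partial>lborel) = ennreal K" ..
  have "K \<ge> 0"
    unfolding K_def set_lebesgue_integral_def using w_le by (intro Bochner_Integration.integral_nonneg) auto

  have "(LINT t:S|lebesgue. w t * (F t)\<^sup>2) \<le> C * K"
    unfolding set_lebesgue_integral_def
  \<comment> \<open>Nonnegativity of \<open>C * K\<close> also covers the default value 0 of the
    integral on the left.\<close>
  proof (rule integral_real_bounded)
    show "0 \<le> C * K" using \<open>C \<ge> 0\<close> \<open>K \<ge> 0\<close> by simp
    have "(\<integral>\<^sup>+t. ennreal (indicator S t *\<^sub>R (w t * (F t)\<^sup>2)) \<partial>lebesgue)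
      \<le> (\<integral>\<^sup>+t. ennreal (w t) * indicator S t
          * (\<integral>\<^sup>+x. ennreal \<bar>g x\<bar> * indicator {min 0 t<..<max 0 t} x \<partial>lborel)\<^sup>2 \<partial>lborel)"
      unfolding nn_integral_completion
    proof (intro nn_integral_mono)
      fix t :: real
      let ?G = "\<integral>\<^sup>+x. ennreal \<bar>g x\<bar> * indicator {min 0 t<..<max 0 t} x \<partial>lborel"
      show "ennreal (indicator S t *\<^sub>R (w t * (F t)\<^sup>2)) \<le> ennreal (w t) * indicator S t * ?G\<^sup>2"
      proof (cases "t \<in> S")
        case True
        have "ennreal \<bar>F t\<bar> \<le> (\<integral>\<^sup>+x. ennreal \<bar>f x\<bar> * indicator {min 0 t<..<max 0 t} x \<partial>lborel)"
          unfolding F_def by (rule interval_lebesgue_integral_abs_le)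
        \<comment> \<open>For \<open>t\<close> in \<open>S\<close> the interval between 0 and
          \<open>t\<close> lies in \<open>S\<close>, where \<open>f\<close> and \<open>g\<close>
          agree almost everywhere.\<close>
        also have "\<dots> = ?G"
          by (intro nn_integral_cong_AE, use fg in eventually_elim)
             (use True in \<open>auto simp: S_def indicator_def min_def max_def split: if_splits\<close>)
        finally have "(ennreal \<bar>F t\<bar>)\<^sup>2 \<le> ?G\<^sup>2" by (rule power_mono) simp
        then have "ennreal (w t) * ennreal ((F t)\<^sup>2) \<le> ennreal (w t) * ?G\<^sup>2"
          by (intro mult_left_mono) (auto simp: ennreal_power)
        then show ?thesis using True w_le by (simp add: ennreal_mult)
      qed simp
    qed
    also have "\<dots> \<le> ennreal C * (\<integral>\<^sup>+x. (ennreal \<bar>g x\<bar>)\<^sup>2 * (ennreal (w x) * indicator S x) \<partial>lborel)"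
      unfolding C_def w_def S_def using assms \<open>l > 0\<close> g by (intro weighted_hardy) auto
    also have "\<dots> = ennreal (C * K)"
      unfolding K using \<open>C \<ge> 0\<close> by (simp add: ennreal_mult')
    finally show "(\<integral>\<^sup>+t. ennreal (indicator S t *\<^sub>R (w t * (F t)\<^sup>2)) \<partial>lebesgue) \<le> ennreal (C * K)" .
  qed
  then show "(LINT t=ereal (-d)..ereal d|lebesgue.
        (exp (-2 * l * frac_power t (n1 + n2) n2) * (LINT \<tau>=ereal 0..ereal t|lebesgue. (f \<tau>))\<^sup>2))
    \<le> 1 / l powr (3/2) * (d powr ((1 - 3 * \<alpha>) / 2) / (sqrt 2 * (1 + \<alpha>) powr (3/2)))
       * (LINT t=ereal (-d)..ereal d|lebesgue.
            ((f t)\<^sup>2 * exp (-2 * l * frac_power t (n1 + n2) n2)))"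
    unfolding w F_def[symmetric] C_def[symmetric]
    using \<open>d > 0\<close> by (simp add: interval_lebesgue_integral_def K_def S_def)
qed

end
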